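(* Let $n\ge 3$, let $k_1,k_2,k_3$ be nonnegative integers, and let $\ell,t$ be integers. With $D_n(\ell,t,k_1,k_2,k_3)$ as defined in the context, we have $$A_{\ell+1}D_n(\ell+1,t,k_1,k_2,k_3)+A_{\ell}D_n(\ell,t,k_1,k_2,k_3)+\bar A_{\ell}D_n(\ell,t-1,k_1,k_2,k_3)+A_{\ell-1}D_n(\ell-1,t,k_1,k_2,k_3)+\bar A_{\ell-1}D_n(\ell-1,t-1,k_1,k_2,k_3)=0,$$ where the five coefficients are $$A_{\ell+1}=(\ell+1)\Big(k_2-k_1-3+\tfrac{k_3}{2}(2n-2-\ell)\Big),$$ $$A_{\ell}=t-n+(\ell+1)\Big(k_2-k_1-2+\tfrac{k_3}{2}(2n-2-\ell)\Big)-(n-\ell)\Big(k_2-2+\tfrac{k_3}{2}(n-1-\ell)\Big),$$ $$\bar A_{\ell}=-\Big(t-n+1+(\ell+1)\Big(k_2-k_1-2+\tfrac{k_3}{2}(2n-2-\ell)\Big)\Big),$$ $$A_{\ell-1}=-\bar A_{\ell-1}=-(n-\ell)\Big(k_2-1+\tfrac{k_3}{2}(n-1-\ell)\Big).$$ (The subscripts on $A,\bar A$ are only names of these five quantities; they are not values of a single function at shifted arguments.)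
   Context: Put $y_i=1-x_i$ for $1\le i\le n$ and $Y=y_1+\cdots+y_n$. For an integer $\ell$, $e_\ell[Y-y_n]$ denotes the $\ell$-th elementary symmetric polynomial in $y_1,\dots,y_{n-1}$, with $e_0=1$ and $e_\ell[Y-y_n]=0$ if $\ell<0$ or $\ell>n-1$. Define $$\Phi_n(\ell,t,k_1,k_2,k_3)=\frac{e_\ell[Y-y_n]\prod_{i=1}^{n}x_i^{k_1}\prod_{i=1}^{n-1}(x_i-x_n)}{x_n^{t}\prod_{i=1}^{n}(1-x_i)^{k_2}\prod_{1\le i<j\le n}(x_i-x_j)^{k_3}},\qquad D_n(\ell,t,k_1,k_2,k_3)=\operatorname*{Res}_{\boldsymbol{x}}\Phi_n(\ell,t,k_1,k_2,k_3),$$ where $\operatorname*{Res}_{\boldsymbol{x}}$ means the coefficient of $x_1^{-1}x_2^{-1}\cdots x_n^{-1}$ in the Laurent series expansion according to $1>x_1>x_2>\cdots>x_n>0$, i.e. $\frac1{1-x_i}=\sum_{k\ge0}x_i^k$ and, for $i<j$, $\frac1{x_i-x_j}=x_i^{-1}\sum_{k\ge0}(x_j/x_i)^k$. *)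

theory Defs
  imports Complex_Main "HOL-Library.Poly_Mapping" "HOL-Library.Dual_Ordered_Lattice"
begin

section \<open>Well-ordered subsets of an ordered group\<close>

lemma wfp_on_less_iff:
  "wfp_on A (<) \<longleftrightarrow> (\<forall>B\<subseteq>A. B \<noteq> {} \<longrightarrow> (\<exists>z\<in>B. \<forall>y\<in>B. z \<le> y))" for A :: "'e::linorder set"
  unfolding wfp_on_iff_ex_minimal by (meson linorder_not_less)

lemma wfp_on_least:
  fixes A :: "'e::linorder set"
  assumes "wfp_on A (<)" "B \<noteq> {}" "B \<subseteq> A"
  shows "\<exists>z. z \<in> B \<and> (\<forall>y\<in>B. z \<le> y)"
  using assms unfolding wfp_on_less_iff by blast

lemma wfp_on_less_subset: "wfp_on B (<) \<Longrightarrow> A \<subseteq> B \<Longrightarrow> wfp_on A (<)" for A :: "'e::linorder set"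
  by (rule wfp_on_subset)

lemma wfp_on_less_finite: "finite A \<Longrightarrow> wfp_on A (<)" for A :: "'e::linorder set"
  unfolding wfp_on_less_iff by (meson Min_in Min_le finite_subset)

lemma wfp_on_less_Un:
  fixes A B :: "'e::linorder set"
  assumes "wfp_on A (<)" "wfp_on B (<)"
  shows "wfp_on (A \<union> B) (<)"
  unfolding wfp_on_less_iff
proof (intro allI impI)
  fix C assume C: "C \<subseteq> A \<union> B" "C \<noteq> {}"
  show "\<exists>z\<in>C. \<forall>y\<in>C. z \<le> y"
  proof (cases "C \<inter> A = {} \<or> C \<inter> B = {}")
    case True
    then have "C \<subseteq> B \<or> C \<subseteq> A" using C by blast
    then show ?thesis using assms C unfolding wfp_on_less_iff by blast
  next
    case False
    obtain a where a: "a \<in> C \<inter> A" "\<And>y. y \<in> C \<inter> A \<Longrightarrow> a \<le> y"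
      using wfp_on_least[OF assms(1), of "C \<inter> A"] False by blast
    obtain b where b: "b \<in> C \<inter> B" "\<And>y. y \<in> C \<inter> B \<Longrightarrow> b \<le> y"
      using wfp_on_least[OF assms(2), of "C \<inter> B"] False by blast
    have "min a b \<in> C" using a b by (simp add: min_def)
    moreover have "\<forall>y\<in>C. min a b \<le> y"
      using a b C by (metis IntI UnE min.coboundedI1 min.coboundedI2 subsetD)
    ultimately show ?thesis by blast
  qed
qed

lemma wfp_on_both_finite:
  fixes A :: "'e::linorder set"
  assumes less: "wfp_on A (<)" and greater: "\<And>B. B \<subseteq> A \<Longrightarrow> B \<noteq> {} \<Longrightarrow> \<exists>z\<in>B. \<forall>y\<in>B. y \<le> z"
  shows "finite A"
proof (rule ccontr)
  assume inf: "infinite A"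
  define B where "B = {x \<in> A. infinite {y \<in> A. y \<le> x}}"
  show False
  proof (cases "B = {}")
    case True
    obtain x where x: "x \<in> A" "\<forall>y\<in>A. y \<le> x"
      using greater[of A] inf by auto
    then have "{y \<in> A. y \<le> x} = A" by blast
    with x inf True show False unfolding B_def by auto
  next
    case False
    have "B \<subseteq> A" unfolding B_def by blast
    from wfp_on_least[OF less False this]
    obtain x where x: "x \<in> B" "\<And>y. y \<in> B \<Longrightarrow> x \<le> y" by blast
    have "{y \<in> A. y \<le> x} = insert x {y \<in> A. y < x}"
      using x(1) unfolding B_def by auto
    then have i: "infinite {y \<in> A. y < x}"
      using x(1) unfolding B_def by auto
    then have "{y \<in> A. y < x} \<noteq> {}" by (metis finite.emptyI)
    then obtain z where z: "z \<in> A" "z < x" "\<forall>y\<in>{y \<in> A. y < x}. y \<le> z"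
      using greater[of "{y \<in> A. y < x}"] by blast
    have "{y \<in> A. y < x} \<subseteq> {y \<in> A. y \<le> z}" using z by blast
    then have "z \<in> B" unfolding B_def using i z(1) infinite_super by blast
    then show False using x(2) z(2) by fastforce
  qed
qed

lemma finite_fibre:
  fixes A B :: "'e::linordered_ab_group_add set"
  assumes A: "wfp_on A (<)" and B: "wfp_on B (<)"
  shows "finite {a \<in> A. m - a \<in> B}"
proof (rule wfp_on_both_finite)
  show "wfp_on {a \<in> A. m - a \<in> B} (<)"
    by (rule wfp_on_less_subset[OF A]) blast
  fix C assume C: "C \<subseteq> {a \<in> A. m - a \<in> B}" "C \<noteq> {}"
  have "(\<lambda>a. m - a) ` C \<noteq> {}" "(\<lambda>a. m - a) ` C \<subseteq> B" using C by auto
  from wfp_on_least[OF B this]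
  obtain z where z: "z \<in> (\<lambda>a. m - a) ` C" "\<And>y. y \<in> (\<lambda>a. m - a) ` C \<Longrightarrow> z \<le> y" by blast
  then obtain c where c: "c \<in> C" "z = m - c" by blast
  have "y \<le> c" if "y \<in> C" for y
    using z(2)[of "m - y"] that c(2) by simp
  with c(1) show "\<exists>z\<in>C. \<forall>y\<in>C. y \<le> z" by blast
qed

lemma wfp_on_sum_step:
  fixes A U :: "'e::linordered_ab_group_add set"
  assumes A: "wfp_on A (<)"
    and U: "\<And>b. b \<in> U \<Longrightarrow> wfp_on {a + b' |a b'. a \<in> A \<and> b' \<in> U \<and> b' < b} (<)"
  shows "wfp_on {a + b |a b. a \<in> A \<and> b \<in> U} (<)"
  unfolding wfp_on_less_iff
proof (intro allI impI)
  fix C assume C: "C \<subseteq> {a + b |a b. a \<in> A \<and> b \<in> U}" "C \<noteq> {}"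
  let ?A = "{a \<in> A. \<exists>b\<in>U. a + b \<in> C}"
  have "?A \<noteq> {}"
  proof -
    obtain c where "c \<in> C" using C(2) by blast
    moreover from this obtain a b where "a \<in> A" "b \<in> U" "c = a + b" using C(1) by blast
    ultimately show ?thesis by auto
  qed
  moreover have "?A \<subseteq> A" by auto
  ultimately obtain a where a: "a \<in> ?A" "\<And>y. y \<in> ?A \<Longrightarrow> a \<le> y"
    using wfp_on_least[OF A, of ?A] by auto
  then obtain b where b: "b \<in> U" "a + b \<in> C" by auto
  let ?C = "{c \<in> C. c < a + b}"
  show "\<exists>z\<in>C. \<forall>y\<in>C. z \<le> y"
  proof (cases "?C = {}")
    case True
    then have "\<forall>y\<in>C. a + b \<le> y" by (auto simp: not_less)
    then show ?thesis using b(2) by (rule bexI)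
  next
    case False
    have "?C \<subseteq> {a + b' |a b'. a \<in> A \<and> b' \<in> U \<and> b' < b}"
    proof
      fix c assume c: "c \<in> ?C"
      then obtain a' b' where ab: "a' \<in> A" "b' \<in> U" "c = a' + b'" using C by blast
      then have "a \<le> a'" using c by (intro a(2)) auto
      have "b' < b"
      proof (rule ccontr)
        assume "\<not> b' < b"
        then have "a + b \<le> a' + b'" using \<open>a \<le> a'\<close> by (intro add_mono) auto
        then show False using c ab(3) by auto
      qed
      then show "c \<in> {a + b' |a b'. a \<in> A \<and> b' \<in> U \<and> b' < b}" using ab by blast
    qed
    then obtain z where z: "z \<in> ?C" "\<And>y. y \<in> ?C \<Longrightarrow> z \<le> y"
      using wfp_on_least[OF U[OF b(1)] False] by auto
    have "z \<le> y" if "y \<in> C" for y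
      using z(1) z(2)[of y] that by (cases "y < a + b") auto
    with z(1) show ?thesis by blast
  qed
qed

lemma wfp_on_less_sum:
  fixes A B :: "'e::linordered_ab_group_add set"
  assumes A: "wfp_on A (<)" and B: "wfp_on B (<)"
  shows "wfp_on {a + b |a b. a \<in> A \<and> b \<in> B} (<)"
proof (rule wfp_on_sum_step[OF A])
  fix b assume b: "b \<in> B"
  from B show "wfp_on {a + b' |a b'. a \<in> A \<and> b' \<in> B \<and> b' < b} (<)"
  proof (induction b rule: wfp_on_induct)
    case in_set
    then show ?case by (rule b)
  next
    case (less b)
    have "wfp_on {a + b' |a b'. a \<in> A \<and> b' \<in> {b' \<in> B. b' < b}} (<)"
    proof (rule wfp_on_sum_step[OF A])
      fix c assume c: "c \<in> {b' \<in> B. b' < b}"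
      have "wfp_on {a + b' |a b'. a \<in> A \<and> b' \<in> B \<and> b' < c} (<)"
        using less(2)[of c] c by simp
      then show "wfp_on {a + b' |a b'. a \<in> A \<and> b' \<in> {b' \<in> B. b' < b} \<and> b' < c} (<)"
        by (rule wfp_on_less_subset) auto
    qed
    then show ?case by (rule wfp_on_less_subset) auto
  qed
qed

inductive_set generated :: "'e::monoid_add set \<Rightarrow> 'e set" for S where
  zero: "0 \<in> generated S"
| step: "a \<in> S \<Longrightarrow> m \<in> generated S \<Longrightarrow> a + m \<in> generated S"

lemma generated_nonneg:
  fixes S :: "'e::linordered_ab_group_add set"
  assumes "\<And>a. a \<in> S \<Longrightarrow> a > 0" "m \<in> generated S"
  shows "0 \<le> m"
  using assms(2)
proof induction
  case (step a m)
  then show ?case using assms(1)[of a] by (simp add: add_nonneg_nonneg)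
qed simp

lemma wfp_on_generated:
  fixes S :: "'e::linordered_ab_group_add set"
  assumes S: "wfp_on S (<)" and pos: "\<And>a. a \<in> S \<Longrightarrow> a > 0"
  shows "wfp_on (generated S) (<)"
proof -
  define bad where "bad C \<longleftrightarrow> C \<subseteq> generated S \<and> (\<forall>z\<in>C. \<exists>y\<in>C. y < z)" for C
  define B where "B = \<Union> (Collect bad)"
  define A where "A = generated S - B"
  have B_gen: "B \<subseteq> generated S" unfolding B_def bad_def by blast
  have bad_B: "bad B" unfolding bad_def
  proof (intro conjI ballI B_gen)
    fix z assume "z \<in> B"
    then obtain C where C: "bad C" "z \<in> C" unfolding B_def by blast
    then obtain y where "y \<in> C" "y < z" unfolding bad_def by blast
    then show "\<exists>y\<in>B. y < z" using C unfolding B_def by blast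
  qed
  have wfA: "wfp_on A (<)"
    unfolding wfp_on_less_iff
  proof (intro allI impI, rule ccontr)
    fix E assume E: "E \<subseteq> A" "E \<noteq> {}" "\<not> (\<exists>z\<in>E. \<forall>y\<in>E. z \<le> y)"
    then have "bad E" unfolding bad_def A_def by (auto simp: not_le)
    then show False using E(1,2) unfolding A_def B_def by blast
  qed
  have strip: "m \<in> B \<longrightarrow> (\<exists>b\<in>B. b \<le> m \<and> b \<in> {s + a |s a. s \<in> S \<and> a \<in> A})" if "m \<in> generated S" for m
    using that
  proof induction
    case zero
    show ?case
    proof
      assume "0 \<in> B"
      then obtain y where "y \<in> B" "y < 0" using bad_B unfolding bad_def by blast
      moreover have "0 \<le> y" using \<open>y \<in> B\<close> B_gen by (intro generated_nonneg[OF pos]) auto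
      ultimately show "\<exists>b\<in>B. b \<le> 0 \<and> b \<in> {s + a |s a. s \<in> S \<and> a \<in> A}" by simp
    qed
  next
    case (step s m)
    show ?case
    proof (cases "m \<in> B")
      case True
      then obtain b where b: "b \<in> B" "b \<le> m" "b \<in> {s + a |s a. s \<in> S \<and> a \<in> A}"
        using step(3) by blast
      have "b \<le> s + m" using b(2) pos[OF step(1)] by (simp add: add_increasing)
      then show ?thesis using b(1,3) by blast
    next
      case False
      then have "m \<in> A" using step(2) unfolding A_def by blast
      show ?thesis
      proof
        assume "s + m \<in> B"
        then show "\<exists>b\<in>B. b \<le> s + m \<and> b \<in> {s + a |s a. s \<in> S \<and> a \<in> A}"
          using step(1) \<open>m \<in> A\<close> by (intro bexI[of _ "s + m"]) auto
      qed
    qed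
  qed
  have "B = {}"
  proof (rule ccontr)
    assume "B \<noteq> {}"
    define E where "E = {s + a |s a. s \<in> S \<and> a \<in> A} \<inter> B"
    obtain m where "m \<in> B" using \<open>B \<noteq> {}\<close> by blast
    then have "E \<noteq> {}" unfolding E_def using strip[of m] B_gen by auto
    moreover have "E \<subseteq> {s + a |s a. s \<in> S \<and> a \<in> A}" unfolding E_def by (rule Int_lower1)
    ultimately obtain z where z: "z \<in> E" "\<And>y. y \<in> E \<Longrightarrow> z \<le> y"
      using wfp_on_least[OF wfp_on_less_sum[OF S wfA], of E] by auto
    obtain y where y: "y \<in> B" "y < z" using bad_B z(1) unfolding bad_def E_def by auto
    then obtain b where b: "b \<in> B" "b \<le> y" "b \<in> {s + a |s a. s \<in> S \<and> a \<in> A}"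
      using strip[of y] B_gen by auto
    then have "z \<le> b" unfolding E_def by (intro z(2)[unfolded E_def] IntI)
    then show False using b(2) y(2) by simp
  qed
  then show ?thesis using wfA unfolding A_def by simp
qed


section \<open>Hahn series\<close>

typedef (overloaded) ('e::linorder, 'a::zero) hahn =
  "{f :: 'e \<Rightarrow> 'a. wfp_on {e. f e \<noteq> 0} (<)}"
  morphisms hahn_coeff Abs_hahn
  by (rule exI[of _ "\<lambda>_. 0"]) (simp add: wfp_on_less_finite)

setup_lifting type_definition_hahn

abbreviation hahn_support :: "('e::linorder, 'a::zero) hahn \<Rightarrow> 'e set"
  where "hahn_support f \<equiv> {e. hahn_coeff f e \<noteq> 0}"

lemma wfp_on_support: "wfp_on (hahn_support f) (<)"
  using hahn_coeff by blast

lemma hahn_eqI: "(\<And>e. hahn_coeff f e = hahn_coeff g e) \<Longrightarrow> f = g"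
  by (metis ext hahn_coeff_inject)

instantiation hahn :: (linorder, ab_group_add) ab_group_add
begin

lift_definition zero_hahn :: "('a, 'b) hahn" is "\<lambda>_. 0"
  by (simp add: wfp_on_less_finite)

lift_definition plus_hahn :: "('a, 'b) hahn \<Rightarrow> ('a, 'b) hahn \<Rightarrow> ('a, 'b) hahn"
  is "\<lambda>f g e. f e + g e"
  by (erule (1) wfp_on_less_subset[OF wfp_on_less_Un]) auto

lift_definition uminus_hahn :: "('a, 'b) hahn \<Rightarrow> ('a, 'b) hahn" is "\<lambda>f e. - f e"
  by simp

definition minus_hahn :: "('a, 'b) hahn \<Rightarrow> ('a, 'b) hahn \<Rightarrow> ('a, 'b) hahn"
  where "minus_hahn f g = f + (- g)"

instance
  by standard (simp_all add: minus_hahn_def, (transfer, simp add: add.assoc add.commute fun_eq_iff)+)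

end

lemmas hahn_coeff_0 [simp] = zero_hahn.rep_eq[THEN fun_cong]
lemmas hahn_coeff_add [simp] = plus_hahn.rep_eq[THEN fun_cong]
lemmas hahn_coeff_uminus [simp] = uminus_hahn.rep_eq[THEN fun_cong]

lemma hahn_coeff_diff [simp]: "hahn_coeff (f - g) e = hahn_coeff f e - hahn_coeff g e"
  unfolding minus_hahn_def hahn_coeff_add hahn_coeff_uminus by simp

lift_definition hahn_monom :: "'e::linorder \<Rightarrow> 'a::zero \<Rightarrow> ('e, 'a) hahn"
  is "\<lambda>e c m. if m = e then c else 0"
  by (rule wfp_on_less_finite) simp

lemma hahn_coeff_monom [simp]: "hahn_coeff (hahn_monom e c) m = (if m = e then c else 0)"
  by transfer simp

instantiation hahn :: (linordered_ab_group_add, comm_ring_1) comm_ring_1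
begin

definition one_hahn :: "('a, 'b) hahn"
  where "one_hahn = hahn_monom 0 1"

lift_definition times_hahn :: "('a, 'b) hahn \<Rightarrow> ('a, 'b) hahn \<Rightarrow> ('a, 'b) hahn"
  is "\<lambda>f g m. \<Sum>a\<in>{a. f a \<noteq> 0 \<and> g (m - a) \<noteq> 0}. f a * g (m - a)"
proof -
  fix f g :: "'a \<Rightarrow> 'b"
  assume "wfp_on {e. f e \<noteq> 0} (<)" "wfp_on {e. g e \<noteq> 0} (<)"
  from wfp_on_less_sum[OF this]
  show "wfp_on {m. (\<Sum>a\<in>{a. f a \<noteq> 0 \<and> g (m - a) \<noteq> 0}. f a * g (m - a)) \<noteq> 0} (<)"
  proof (rule wfp_on_less_subset, intro subsetI)
    fix m assume "m \<in> {m. (\<Sum>a\<in>{a. f a \<noteq> 0 \<and> g (m - a) \<noteq> 0}. f a * g (m - a)) \<noteq> 0}"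
    then have "(\<Sum>a\<in>{a. f a \<noteq> 0 \<and> g (m - a) \<noteq> 0}. f a * g (m - a)) \<noteq> 0" by simp
    then obtain a where "a \<in> {a. f a \<noteq> 0 \<and> g (m - a) \<noteq> 0}"
      by (rule sum.not_neutral_contains_not_neutral)
    then have "f a \<noteq> 0" "g (m - a) \<noteq> 0" by auto
    then show "m \<in> {a + b |a b. a \<in> {e. f e \<noteq> 0} \<and> b \<in> {e. g e \<noteq> 0}}"
      by (intro CollectI exI[of _ a] exI[of _ "m - a"]) simp
  qed
qed

lemma hahn_coeff_mult_superset:
  fixes f g :: "('a, 'b) hahn"
  assumes "finite T" "{a. hahn_coeff f a \<noteq> 0 \<and> hahn_coeff g (m - a) \<noteq> 0} \<subseteq> T"
  shows "hahn_coeff (f * g) m = (\<Sum>a\<in>T. hahn_coeff f a * hahn_coeff g (m - a))"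
  unfolding times_hahn.rep_eq
  by (rule sum.mono_neutral_left[OF assms]) auto

lemma finite_mult_support:
  fixes f g :: "('a, 'b) hahn"
  shows "finite {a. hahn_coeff f a \<noteq> 0 \<and> hahn_coeff g (m - a) \<noteq> 0}"
  using finite_fibre[OF wfp_on_support wfp_on_support, of f m g] by simp

lemma hahn_mult_commute: "f * g = g * f" for f g :: "('a, 'b) hahn"
proof (rule hahn_eqI)
  fix m
  show "hahn_coeff (f * g) m = hahn_coeff (g * f) m"
    unfolding times_hahn.rep_eq
    by (rule sum.reindex_bij_witness[of _ "\<lambda>a. m - a" "\<lambda>a. m - a"]) (auto simp: mult.commute)
qed

lemma hahn_mult_add: "(f + g) * h = f * h + g * h" for f g h :: "('a, 'b) hahn"
proof (rule hahn_eqI)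
  fix m
  let ?T = "{a. hahn_coeff f a \<noteq> 0 \<and> hahn_coeff h (m - a) \<noteq> 0} \<union>
            {a. hahn_coeff g a \<noteq> 0 \<and> hahn_coeff h (m - a) \<noteq> 0}"
  have "finite ?T" using finite_mult_support by blast
  then have *: "hahn_coeff (p * h) m = (\<Sum>a\<in>?T. hahn_coeff p a * hahn_coeff h (m - a))"
    if "p \<in> {f + g, f, g}" for p
    by (rule hahn_coeff_mult_superset) (use that in auto)
  show "hahn_coeff ((f + g) * h) m = hahn_coeff (f * h + g * h) m"
    by (simp add: * sum.distrib distrib_right)
qed

lemma hahn_coeff_monom_mult:
  "hahn_coeff (hahn_monom e c * f) m = c * hahn_coeff f (m - e)" for f :: "('a, 'b) hahn"
  by (subst hahn_coeff_mult_superset[of "{e}"]) (auto split: if_splits)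

lemma hahn_mult_assoc: "f * g * h = f * (g * h)" for f g h :: "('a, 'b) hahn"
proof (rule hahn_eqI)
  fix m
  let ?f = "hahn_coeff f" and ?g = "hahn_coeff g" and ?h = "hahn_coeff h"
  let ?F = "hahn_support f" and ?G = "hahn_support g" and ?H = "hahn_support h"
  define A where "A = {a \<in> {b + c |b c. b \<in> ?F \<and> c \<in> ?G}. m - a \<in> ?H}"
  define B where "B = {b \<in> ?F. m - b \<in> {c + d |c d. c \<in> ?G \<and> d \<in> ?H}}"
  have finA: "finite A" unfolding A_def
    by (intro finite_fibre wfp_on_less_sum wfp_on_support)
  have finB: "finite B" unfolding B_def
    by (intro finite_fibre wfp_on_less_sum wfp_on_support)
  have B_iff: "b \<in> B" if "?f b \<noteq> 0" "?g (a - b) \<noteq> 0" "?h (m - a) \<noteq> 0" for a b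
  proof -
    have "m - b = (a - b) + (m - a)" by simp
    with that show ?thesis unfolding B_def by blast
  qed
  have A_iff: "a \<in> A" if "?f b \<noteq> 0" "?g (a - b) \<noteq> 0" "?h (m - a) \<noteq> 0" for a b
  proof -
    have "a = b + (a - b)" by simp
    with that show ?thesis unfolding A_def by blast
  qed
  have sub: "{b. ?f b \<noteq> 0 \<and> ?g (a - b) \<noteq> 0} \<subseteq> B" if "?h (m - a) \<noteq> 0" for a
    using B_iff that by blast
  have "hahn_coeff (f * g * h) m = (\<Sum>a\<in>A. hahn_coeff (f * g) a * ?h (m - a))"
  proof (rule hahn_coeff_mult_superset[OF finA], intro subsetI)
    fix a assume a: "a \<in> {a. hahn_coeff (f * g) a \<noteq> 0 \<and> ?h (m - a) \<noteq> 0}"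
    then have "(\<Sum>b\<in>B. ?f b * ?g (a - b)) \<noteq> 0"
      using hahn_coeff_mult_superset[OF finB sub[of a]] by simp
    then obtain b where "?f b * ?g (a - b) \<noteq> 0" by (rule sum.not_neutral_contains_not_neutral)
    then show "a \<in> A" using a by (intro A_iff[of b]) auto
  qed
  also have "\<dots> = (\<Sum>a\<in>A. \<Sum>b\<in>B. ?f b * ?g (a - b) * ?h (m - a))"
  proof (rule sum.cong[OF refl])
    fix a
    show "hahn_coeff (f * g) a * ?h (m - a) = (\<Sum>b\<in>B. ?f b * ?g (a - b) * ?h (m - a))"
      using hahn_coeff_mult_superset[OF finB sub[of a]]
      by (cases "?h (m - a) = 0") (simp_all add: sum_distrib_right)
  qed
  also have "\<dots> = (\<Sum>b\<in>B. \<Sum>a\<in>A. ?f b * ?g (a - b) * ?h (m - a))"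
    by (rule sum.swap)
  also have "\<dots> = (\<Sum>b\<in>B. ?f b * hahn_coeff (g * h) (m - b))"
  proof (rule sum.cong[OF refl])
    fix b assume "b \<in> B"
    then have b: "?f b \<noteq> 0" unfolding B_def by blast
    have "hahn_coeff (g * h) (m - b) =
        (\<Sum>c\<in>(\<lambda>a. a - b) ` A. ?g c * ?h (m - b - c))"
    proof (rule hahn_coeff_mult_superset)
      show "finite ((\<lambda>a. a - b) ` A)" using finA by blast
      show "{c. ?g c \<noteq> 0 \<and> ?h (m - b - c) \<noteq> 0} \<subseteq> (\<lambda>a. a - b) ` A"
      proof
        fix c assume "c \<in> {c. ?g c \<noteq> 0 \<and> ?h (m - b - c) \<noteq> 0}"
        then have "b + c \<in> A" using b by (intro A_iff[of b]) (auto simp: algebra_simps)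
        then show "c \<in> (\<lambda>a. a - b) ` A" by (intro image_eqI[of _ _ "b + c"]) auto
      qed
    qed
    also have "\<dots> = (\<Sum>a\<in>A. ?g (a - b) * ?h (m - a))"
      by (subst sum.reindex) (auto simp: inj_on_def algebra_simps)
    finally show "(\<Sum>a\<in>A. ?f b * ?g (a - b) * ?h (m - a)) = ?f b * hahn_coeff (g * h) (m - b)"
      by (simp add: sum_distrib_left mult.assoc)
  qed
  also have "\<dots> = hahn_coeff (f * (g * h)) m"
  proof (rule hahn_coeff_mult_superset[OF finB, symmetric], intro subsetI)
    fix b assume b: "b \<in> {b. ?f b \<noteq> 0 \<and> hahn_coeff (g * h) (m - b) \<noteq> 0}"
    then have "(\<Sum>c\<in>{c. ?g c \<noteq> 0 \<and> ?h (m - b - c) \<noteq> 0}. ?g c * ?h (m - b - c)) \<noteq> 0"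
      by (simp add: times_hahn.rep_eq)
    then obtain c where "c \<in> {c. ?g c \<noteq> 0 \<and> ?h (m - b - c) \<noteq> 0}"
      by (rule sum.not_neutral_contains_not_neutral)
    then show "b \<in> B" using b by (intro B_iff[of b "b + c"]) (auto simp: algebra_simps)
  qed
  finally show "hahn_coeff (f * g * h) m = hahn_coeff (f * (g * h)) m" .
qed

instance
proof
  fix f g h :: "('a, 'b) hahn"
  show "f * g * h = f * (g * h)" by (rule hahn_mult_assoc)
  show "f * g = g * f" by (rule hahn_mult_commute)
  show "(f + g) * h = f * h + g * h" by (rule hahn_mult_add)
  show "1 * f = f" by (rule hahn_eqI) (simp add: one_hahn_def hahn_coeff_monom_mult)
  have "hahn_coeff (0 :: ('a, 'b) hahn) 0 \<noteq> hahn_coeff 1 0" by (simp add: one_hahn_def)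
  then show "(0 :: ('a, 'b) hahn) \<noteq> 1" by metis
qed

end

lemma hahn_coeff_1 [simp]: "hahn_coeff 1 m = (if m = 0 then 1 else 0)"
  by (simp add: one_hahn_def)

lemma hahn_monom_mult: "hahn_monom d a * hahn_monom e b = hahn_monom (d + e) (a * b)"
  by (rule hahn_eqI) (auto simp: hahn_coeff_monom_mult algebra_simps)

lemma hahn_one_minus_invertible:
  fixes g :: "('e::linordered_ab_group_add, 'a::comm_ring_1) hahn"
  assumes pos: "\<And>a. hahn_coeff g a \<noteq> 0 \<Longrightarrow> a > 0"
  shows "\<exists>h. (1 - g) * h = 1"
proof -
  let ?S = "hahn_support g"
  define M where "M = generated ?S"
  have wfM: "wfp_on M (<)"
    unfolding M_def by (rule wfp_on_generated[OF wfp_on_support]) (simp add: pos)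
  define R where "R = {(x, y). x < y \<and> x \<in> M \<and> y \<in> M}"
  define F where "F h m = (if m \<in> M then (if m = 0 then 1 else 0) +
    (\<Sum>a\<in>{a \<in> ?S. m - a \<in> M}. hahn_coeff g a * h (m - a)) else 0)" for h m
  define h where "h = wfrec R F"
  have "wf R"
    using wfM unfolding wfp_on_iff_wfp[of M] wfp_def R_def by simp
  have h: "h m = F h m" for m
  proof -
    have "h m = F (cut h R m) m" unfolding h_def by (rule wfrec[OF \<open>wf R\<close>])
    also have "\<dots> = F h m"
      unfolding F_def by (auto intro!: sum.cong simp: cut_def R_def pos)
    finally show ?thesis .
  qed
  have h0: "h m = 0" if "m \<notin> M" for m using that by (subst h) (simp add: F_def)
  then have sub: "{m. h m \<noteq> 0} \<subseteq> M" by blast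
  define H where "H = Abs_hahn h"
  have H: "hahn_coeff H = h"
    unfolding H_def by (rule Abs_hahn_inverse) (simp add: wfp_on_less_subset[OF wfM sub])
  have "H = 1 + g * H"
  proof (rule hahn_eqI)
    fix m
    have eq: "hahn_coeff (g * H) m = (\<Sum>a\<in>{a \<in> ?S. m - a \<in> M}. hahn_coeff g a * h (m - a))"
      by (subst hahn_coeff_mult_superset[OF finite_fibre[OF wfp_on_support wfM]])
         (use sub H in auto)
    show "hahn_coeff H m = hahn_coeff (1 + g * H) m"
    proof (cases "m \<in> M")
      case True
      then show ?thesis by (simp only: hahn_coeff_add eq H, subst h) (simp add: F_def)
    next
      case False
      have "m \<in> M" if "a \<in> ?S" "m - a \<in> M" for a
        using generated.step[of a ?S "m - a"] that unfolding M_def by simp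
      then have "{a \<in> ?S. m - a \<in> M} = {}" using False by blast
      moreover have "m \<noteq> 0" using False generated.zero unfolding M_def by metis
      ultimately show ?thesis using False by (simp only: hahn_coeff_add eq H) (simp add: h0)
    qed
  qed
  then have "(1 - g) * H = 1" by (simp add: algebra_simps)
  then show ?thesis by blast
qed

lemma hahn_invertible:
  fixes f :: "('e::linordered_ab_group_add, 'a::field) hahn"
  assumes "f \<noteq> 0"
  shows "\<exists>h. f * h = 1"
proof -
  have "hahn_support f \<noteq> {}" using assms by (auto intro: hahn_eqI)
  then obtain e where e: "hahn_coeff f e \<noteq> 0" "\<And>y. hahn_coeff f y \<noteq> 0 \<Longrightarrow> e \<le> y"
    using wfp_on_least[OF wfp_on_support \<open>hahn_support f \<noteq> {}\<close> order_refl] by auto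
  let ?c = "hahn_coeff f e"
  define g where "g = 1 - hahn_monom (- e) (inverse ?c) * f"
  have "\<exists>h. (1 - g) * h = 1"
  proof (rule hahn_one_minus_invertible)
    fix a assume "hahn_coeff g a \<noteq> 0"
    then have a: "a \<noteq> 0" "hahn_coeff f (a + e) \<noteq> 0"
      using e(1) by (auto simp: g_def hahn_coeff_monom_mult split: if_splits)
    then show "a > 0" using e(2)[OF a(2)] by simp
  qed
  then obtain h where "hahn_monom (- e) (inverse ?c) * f * h = 1" by (auto simp: g_def)
  then have "f * (hahn_monom (- e) (inverse ?c) * h) = 1" by (simp add: ac_simps)
  then show ?thesis by blast
qed

instantiation hahn :: (linordered_ab_group_add, field) field
begin

definition inverse_hahn :: "('a, 'b) hahn \<Rightarrow> ('a, 'b) hahn"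
  where "inverse_hahn f = (if f = 0 then 0 else SOME h. f * h = 1)"

definition divide_hahn :: "('a, 'b) hahn \<Rightarrow> ('a, 'b) hahn \<Rightarrow> ('a, 'b) hahn"
  where "divide_hahn f g = f * inverse g"

instance
proof
  fix f g :: "('a, 'b) hahn"
  show "inverse f * f = 1" if "f \<noteq> 0"
    using someI_ex[OF hahn_invertible[OF that]] that by (simp add: inverse_hahn_def mult.commute)
  show "f div g = f * inverse g" by (rule divide_hahn_def)
  show "inverse (0 :: ('a, 'b) hahn) = 0" by (simp add: inverse_hahn_def)
qed

end

lemma inverse_hahn_monom:
  "c \<noteq> 0 \<Longrightarrow> inverse (hahn_monom e c) = hahn_monom (- e) (inverse c)"
  for e :: "'e::linordered_ab_group_add" and c :: "'a::field"
  by (rule inverse_unique) (simp add: hahn_monom_mult one_hahn_def)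

lemma hahn_coeff_inverse_one_minus_monom:
  fixes e :: "'e::linordered_ab_group_add"
  assumes e: "e > 0"
  shows "hahn_coeff (inverse (1 - hahn_monom e (1::'a::field))) m =
    (if m \<in> generated {e} then 1 else 0)"
proof -
  define G where "G = Abs_hahn (\<lambda>m. if m \<in> generated {e} then 1 else (0::'a))"
  have wf: "wfp_on (generated {e}) (<)"
    by (rule wfp_on_generated) (use e in \<open>auto simp: wfp_on_less_finite\<close>)
  have G: "hahn_coeff G m = (if m \<in> generated {e} then 1 else 0)" for m
    unfolding G_def by (subst Abs_hahn_inverse) (simp_all add: wf)
  have iff: "m \<in> generated {e} \<longleftrightarrow> m = 0 \<or> m - e \<in> generated {e}" for m
    by (subst generated.simps) (auto intro: generated.intros intro!: exI[of _ "m - e"])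
  have neg: "- e \<notin> generated {e}"
  proof
    assume "- e \<in> generated {e}"
    then have "0 \<le> - e" by (rule generated_nonneg[rotated]) (simp add: e)
    with e show False by simp
  qed
  then have "(1 - hahn_monom e 1) * G = 1"
  proof (intro hahn_eqI)
    fix m
    show "hahn_coeff ((1 - hahn_monom e 1) * G) m = hahn_coeff 1 m"
      using iff[of m] neg by (simp add: left_diff_distrib hahn_coeff_monom_mult G generated.zero)
  qed
  then show ?thesis using G by (simp add: inverse_unique)
qed


section \<open>Iterated Laurent series in \<open>x\<^sub>1 > x\<^sub>2 > \<dots>\<close>\<close>

text \<open>
  The Laurent monomial with exponents \<open>a\<^sub>1, a\<^sub>2, \<dots>\<close> is encoded by its exponent vector, and the
  supports of series are well-ordered for the lexicographic order of exponent vectors in which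
  the variable of the \<^emph>\<open>largest\<close> index dominates.  This is why the index type is \<open>nat dual\<close>:
  the order on \<open>poly_mapping\<close> gives precedence to the least index.  Series in
  \<open>x\<^sub>1, \<dots>, x\<^sub>n\<close> with such supports are exactly the iterated Laurent series
  \<open>\<rat>((x\<^sub>1))((x\<^sub>2))\<dots>((x\<^sub>n))\<close>, in which \<open>x\<^sub>j / x\<^sub>i\<close> is infinitesimal for \<open>i < j\<close>.
\<close>

instance dual :: (linorder) linorder
proof
  fix x y :: "'a dual"
  show "x \<le> y \<or> y \<le> x"
    using linear[of "undual x" "undual y"] by (simp add: less_eq_dual_def disj_commute)
qed

type_synonym laurent = "(nat dual \<Rightarrow>\<^sub>0 int, rat) hahn"

definition var_exp :: "nat \<Rightarrow> int \<Rightarrow> (nat dual \<Rightarrow>\<^sub>0 int)"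
  where "var_exp i k = Poly_Mapping.single (dual i) k"

definition X :: "nat \<Rightarrow> laurent"
  where "X i = hahn_monom (var_exp i 1) 1"

definition Res :: "nat \<Rightarrow> laurent \<Rightarrow> rat"
  where "Res n f = hahn_coeff f (\<Sum>i=1..n. var_exp i (-1))"

text \<open>Division in the field \<open>laurent\<close> performs the expansions prescribed by \<open>1 > x\<^sub>1 > x\<^sub>2 > \<dots>\<close>.\<close>

lemma var_exp_pos: "var_exp i 1 > 0"
  unfolding var_exp_def less_poly_mapping.rep_eq less_fun_def
  by (rule exI[of _ "dual i"]) (auto simp: lookup_single)

lemma var_exp_diff_pos: "i < j \<Longrightarrow> var_exp j 1 - var_exp i 1 > 0"
  unfolding var_exp_def less_poly_mapping.rep_eq less_fun_def
  by (rule exI[of _ "dual j"])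
     (auto simp: lookup_single lookup_minus when_def less_dual_def)

lemma generated_multiples:
  fixes f :: "nat \<Rightarrow> 'e::monoid_add"
  assumes "\<And>k. f (Suc k) = e + f k" "f 0 = 0"
  shows "generated {e} = range f"
proof -
  have "m \<in> range f" if "m \<in> generated {e}" for m
    using that
  proof induction
    case zero
    show ?case by (metis assms(2) rangeI)
  next
    case (step a m)
    then obtain k where "m = f k" "a = e" by auto
    then have "a + m = f (Suc k)" by (simp add: assms(1))
    then show ?case by simp
  qed
  moreover have "f k \<in> generated {e}" for k
    by (induction k) (auto simp: assms intro: generated.intros)
  ultimately show ?thesis by blast
qed

lemma expansion_inverse_one_minus_X:
  "hahn_coeff (inverse (1 - X i)) m = (if \<exists>k::nat. m = var_exp i (int k) then 1 else 0)"
proof -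
  have "generated {var_exp i 1} = range (\<lambda>k::nat. var_exp i (int k))"
    by (rule generated_multiples) (simp_all add: var_exp_def single_add[symmetric])
  then show ?thesis
    unfolding X_def by (subst hahn_coeff_inverse_one_minus_monom[OF var_exp_pos]) auto
qed

lemma expansion_inverse_X_diff:
  assumes "i < j"
  shows "hahn_coeff (inverse (X i - X j)) m =
    (if \<exists>k::nat. m = var_exp i (-1 - int k) + var_exp j (int k) then 1 else 0)"
proof -
  let ?e = "var_exp j 1 - var_exp i 1"
  have "X i - X j = X i * (1 - hahn_monom ?e 1)"
    by (simp add: X_def right_diff_distrib hahn_monom_mult)
  then have "inverse (X i - X j) =
      hahn_monom (- var_exp i 1) 1 * inverse (1 - hahn_monom ?e (1::rat))"
    by (simp add: X_def inverse_hahn_monom mult.commute)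
  moreover have "generated {?e} = range (\<lambda>k::nat. var_exp j (int k) - var_exp i (int k))"
    by (rule generated_multiples) (simp_all add: var_exp_def single_add algebra_simps)
  moreover have "m + var_exp i 1 = var_exp j (int k) - var_exp i (int k) \<longleftrightarrow>
      m = var_exp i (-1 - int k) + var_exp j (int k)" for k
    by (auto simp: var_exp_def single_diff single_uminus algebra_simps)
  ultimately show ?thesis
    by (simp add: hahn_coeff_monom_mult hahn_coeff_inverse_one_minus_monom[OF var_exp_diff_pos[OF assms]]
        image_iff)
qed


section \<open>The rational functions \<open>\<Phi>\<^sub>n\<close> and their residues\<close>

text \<open>
  The elementary symmetric polynomial is taken in the family \<open>(y i)\<^bsub>i \<in> I\<^esub>\<close>.  No subset
  has the cardinality \<open>l\<close> if \<open>l < 0\<close> or \<open>l > card I\<close>, so that the value is then \<open>0\<close>.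
\<close>

definition elem_sym :: "int \<Rightarrow> nat set \<Rightarrow> (nat \<Rightarrow> 'a::comm_ring_1) \<Rightarrow> 'a"
  where "elem_sym l I y = (\<Sum>J | J \<subseteq> I \<and> int (card J) = l. \<Prod>i\<in>J. y i)"

definition Phi :: "nat \<Rightarrow> int \<Rightarrow> int \<Rightarrow> nat \<Rightarrow> nat \<Rightarrow> nat \<Rightarrow> laurent"
  where "Phi n l t k1 k2 k3 =
    elem_sym l {1..n-1} (\<lambda>i. 1 - X i) * (\<Prod>i=1..n. X i ^ k1) * (\<Prod>i=1..n-1. X i - X n) /
    (X n powi t * (\<Prod>i=1..n. (1 - X i) ^ k2) *
     (\<Prod>(i, j) | 1 \<le> i \<and> i < j \<and> j \<le> n. (X i - X j) ^ k3))"

definition D :: "nat \<Rightarrow> int \<Rightarrow> int \<Rightarrow> nat \<Rightarrow> nat \<Rightarrow> nat \<Rightarrow> rat"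
  where "D n l t k1 k2 k3 = Res n (Phi n l t k1 k2 k3)"

end

theory Submission
  imports Defs
begin

text \<open>
  Let \<open>E\<^sub>i\<close> be the \<open>l\<close>-th elementary symmetric polynomial in the \<open>y\<^sub>j\<close> with \<open>j \<noteq> i\<close>, and let
  \<open>\<Psi>\<close> be \<open>\<Phi>\<^sub>n\<close> without its factor \<open>e\<^sub>l\<close>. Since residues of derivatives vanish, so does the residue
  of the divergence \<open>\<Sum>\<^sub>i \<partial>(x\<^sub>i y\<^sub>i E\<^sub>i \<Psi>)/\<partial>x\<^sub>i\<close>, which is
  \<open>\<Sum>\<^sub>i (1 + \<theta>\<^sub>i) (y\<^sub>i E\<^sub>i \<Psi>)\<close> in terms of the Euler operators \<open>\<theta>\<^sub>i = x\<^sub>i \<partial>/\<partial>x\<^sub>i\<close>.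
  The derivation \<open>\<Sum>\<^sub>i y\<^sub>i E\<^sub>i \<theta>\<^sub>i\<close> has a polynomial logarithmic derivative at every factor of
  \<open>\<Psi>\<close>: the numerator arising from \<open>x\<^sub>a - x\<^sub>b\<close> is divisible by \<open>x\<^sub>a - x\<^sub>b\<close>. The divergence is
  therefore \<open>\<Psi>\<close> times a polynomial, and summing the elementary symmetric polynomials turns it
  into minus the left-hand side of the recurrence.
\<close>

section \<open>Derivations and logarithmic derivatives\<close>

text \<open>Two kinds of derivation use these rules: the Euler operators need only the product rule,
  while their combination \<open>V\<close> in \<open>divergence\<close> needs logarithmic
  derivatives.\<close>

locale derivation =
  fixes d :: "'a::field \<Rightarrow> 'a"
  assumes add: "d (f + g) = d f + d g"
    and mult: "d (f * g) = d f * g + f * d g"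
begin

lemma zero [simp]: "d 0 = 0"
  by (metis add add.right_neutral add_left_cancel)

lemma one [simp]: "d 1 = 0"
  by (metis mult mult_1 mult_1_right add.right_neutral add_left_cancel)

lemma uminus: "d (- f) = - d f"
proof -
  have "d f + d (- f) = 0" by (simp flip: add)
  then show ?thesis by (metis minus_unique)
qed

lemma diff: "d (f - g) = d f - d g"
  using add[of f "- g"] by (simp add: uminus)

lemma sum: "d (\<Sum>i\<in>A. f i) = (\<Sum>i\<in>A. d (f i))"
  by (induction A rule: infinite_finite_induct) (simp_all add: add)

lemma prod_eq_0: "(\<And>i. i \<in> A \<Longrightarrow> d (f i) = 0) \<Longrightarrow> d (\<Prod>i\<in>A. f i) = 0"
  by (induction A rule: infinite_finite_induct) (simp_all add: mult)

lemma elem_sym_eq_0: "(\<And>i. i \<in> I \<Longrightarrow> d (y i) = 0) \<Longrightarrow> d (elem_sym l I y) = 0"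
  unfolding elem_sym_def sum by (intro sum.neutral ballI prod_eq_0) auto

definition dlog :: "'a \<Rightarrow> 'a"
  where "dlog f = d f / f"

lemma dlog_one [simp]: "dlog 1 = 0"
  by (simp add: dlog_def)

lemma dlog_mult: "f \<noteq> 0 \<Longrightarrow> g \<noteq> 0 \<Longrightarrow> dlog (f * g) = dlog f + dlog g"
  by (simp add: dlog_def mult field_simps)

lemma dlog_inverse: "dlog (inverse f) = - dlog f"
proof (cases "f = 0")
  case False
  then have "dlog f + dlog (inverse f) = 0"
    by (subst dlog_mult[symmetric]) auto
  then show ?thesis by (metis minus_unique)
\<comment> \<open>Both sides are 0 at \<open>f = 0\<close>, since \<open>inverse 0 = 0\<close> and
  division by 0 gives 0.\<close>
qed (simp add: dlog_def)

lemma dlog_divide: "f \<noteq> 0 \<Longrightarrow> g \<noteq> 0 \<Longrightarrow> dlog (f / g) = dlog f - dlog g"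
  by (simp add: divide_inverse dlog_mult dlog_inverse)

lemma dlog_power: "f \<noteq> 0 \<Longrightarrow> dlog (f ^ k) = of_nat k * dlog f"
  by (induction k) (simp_all add: dlog_mult algebra_simps)

lemma dlog_power_int: "f \<noteq> 0 \<Longrightarrow> dlog (f powi k) = of_int k * dlog f"
  by (simp add: power_int_def dlog_power dlog_inverse)

lemma dlog_prod: "(\<And>i. i \<in> A \<Longrightarrow> f i \<noteq> 0) \<Longrightarrow> dlog (\<Prod>i\<in>A. f i) = (\<Sum>i\<in>A. dlog (f i))"
  by (induction A rule: infinite_finite_induct) (simp_all add: dlog_mult)

end

section \<open>Sums of elementary symmetric polynomials\<close>

lemma elem_sym_empty: "elem_sym l {} y = (if l = 0 then 1 else 0)"
proof -
  have *: "{J. J \<subseteq> {} \<and> int (card J) = l} = (if l = 0 then {{}} else {})" by auto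
  show ?thesis unfolding elem_sym_def * by simp
qed

text \<open>Subsets of \<open>insert i I\<close> are split by whether they contain \<open>i\<close>;
  deleting \<open>i\<close> matches those that do with the subsets of \<open>I\<close> of one
  element less.\<close>

lemma elem_sym_insert:
  assumes "finite I" "i \<notin> I"
  shows "elem_sym l (insert i I) y = elem_sym l I y + y i * elem_sym (l - 1) I y"
proof -
  let ?A = "{J. J \<subseteq> I \<and> int (card J) = l}" and ?B = "{J. J \<subseteq> I \<and> int (card J) = l - 1}"
  have fin: "finite ?A" "finite ?B"
    using assms by auto
  have card: "card (insert i J) = Suc (card J)" if "J \<subseteq> I" for J
    using that assms finite_subset[OF that] by (intro card_insert_disjoint) auto
  have "{J. J \<subseteq> insert i I \<and> int (card J) = l} = ?A \<union> insert i ` ?B" (is "?L = ?R")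
  proof (intro equalityI subsetI)
    fix J assume J: "J \<in> ?L"
    show "J \<in> ?R"
    proof (cases "i \<in> J")
      case True
      then have "J = insert i (J - {i})" "J - {i} \<subseteq> I" using J by auto
      moreover from this card[of "J - {i}"] have "J - {i} \<in> ?B" using J by auto
      ultimately show ?thesis by blast
    qed (use J in auto)
  qed (auto simp: card)
  moreover have "?A \<inter> insert i ` ?B = {}"
    using assms by auto
  moreover have "inj_on (insert i) ?B"
    using assms by (intro inj_onI) (auto simp: insert_ident subset_iff)
  moreover have "(\<Prod>k\<in>insert i J. y k) = y i * (\<Prod>k\<in>J. y k)" if "J \<in> ?B" for J
    using that assms finite_subset[of J I] by (intro prod.insert) auto
  ultimately show ?thesis
    using fin by (simp add: elem_sym_def sum.union_disjoint sum.reindex sum_distrib_left)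
qed

lemma elem_sym_remove:
  assumes "finite I" "i \<in> I"
  shows "elem_sym l I y = elem_sym l (I - {i}) y + y i * elem_sym (l - 1) (I - {i}) y"
  using elem_sym_insert[of "I - {i}" i l y] assms by (simp add: insert_absorb)

text \<open>Induction step common to the next two sums, with weights \<open>c i = 1\<close> and
  \<open>c i = y i\<close>.\<close>

lemma sum_elem_sym_remove_insert:
  assumes "finite I" "k \<notin> I"
  shows "(\<Sum>i\<in>I. c i * elem_sym l (insert k I - {i}) y) =
    (\<Sum>i\<in>I. c i * elem_sym l (I - {i}) y) + y k * (\<Sum>i\<in>I. c i * elem_sym (l - 1) (I - {i}) y)"
proof -
  have "c i * elem_sym l (insert k I - {i}) y =
      c i * elem_sym l (I - {i}) y + y k * (c i * elem_sym (l - 1) (I - {i}) y)" if "i \<in> I" for i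
  proof -
    have "insert k I - {i} = insert k (I - {i})" using that assms by auto
    then show ?thesis using assms by (simp add: elem_sym_insert algebra_simps)
  qed
  then show ?thesis by (simp add: sum.distrib sum_distrib_left)
qed

text \<open>Counting behind it: a subset of size \<open>l\<close> avoids \<open>i\<close> for
  exactly \<open>card I - l\<close> choices of \<open>i\<close>.\<close>

lemma sum_elem_sym_remove:
  assumes "finite I"
  shows "(\<Sum>i\<in>I. elem_sym l (I - {i}) y) = of_int (int (card I) - l) * elem_sym l I y"
  using assms
proof (induction I arbitrary: l rule: finite_induct)
  case (insert k I)
  have "of_nat (card I) * elem_sym l I y = (\<Sum>i\<in>I. elem_sym l (I - {i}) y) + of_int l * elem_sym l I y"
    for l using insert.IH[of l] by (simp add: algebra_simps)
  then show ?case
    using insert(1,2) sum_elem_sym_remove_insert[OF insert(1,2), of "\<lambda>_. 1" l y]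
    by (simp add: elem_sym_insert algebra_simps)
qed (simp add: elem_sym_empty)

text \<open>Counting behind it: a subset of size \<open>l + 1\<close> arises once from each of its
  elements, taken as \<open>i\<close>.\<close>

lemma sum_mult_elem_sym_remove:
  assumes "finite I"
  shows "(\<Sum>i\<in>I. y i * elem_sym l (I - {i}) y) = of_int (l + 1) * elem_sym (l + 1) I y"
  using assms
proof (induction I arbitrary: l rule: finite_induct)
  case empty
  \<comment> \<open>For \<open>l = - 1\<close> the polynomial on the right is 1, but its factor
    \<open>l + 1\<close> vanishes.\<close>
  then show ?case by (cases "l = - 1") (simp_all add: elem_sym_empty)
next
  case (insert k I)
  then show ?case
    using sum_elem_sym_remove_insert[OF insert(1,2), of y l y]
    by (simp add: elem_sym_insert algebra_simps)
qed

text \<open>The divided difference of \<open>y i * (1 - y i) * elem_sym l (I - {i}) y\<close>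
  between \<open>a\<close> and \<open>b\<close>, written out as a polynomial.\<close>

definition pair_term :: "int \<Rightarrow> nat set \<Rightarrow> (nat \<Rightarrow> 'a::comm_ring_1) \<Rightarrow> nat \<Rightarrow> nat \<Rightarrow> 'a"
  where "pair_term l I y a b = (1 - y a - y b) * elem_sym l (I - {a, b}) y
    - y a * y b * elem_sym (l - 1) (I - {a, b}) y"

lemma pair_term_commute: "pair_term l I y a b = pair_term l I y b a"
  by (simp add: pair_term_def insert_commute algebra_simps)

text \<open>Both polynomials on the right are expanded over \<open>I - {a, b}\<close>; the two
  coefficients that arise are each divisible by \<open>y a - y b\<close>.\<close>

lemma pair_term_divided_difference:
  assumes "finite I" "a \<in> I" "b \<in> I" "a \<noteq> b"
  shows "(y a - y b) * pair_term l I y a b =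
    y a * (1 - y a) * elem_sym l (I - {a}) y - y b * (1 - y b) * elem_sym l (I - {b}) y"
proof -
  have "I - {a} - {b} = I - {a, b}" "I - {b} - {a} = I - {a, b}" by auto
  then show ?thesis
    using elem_sym_remove[of "I - {a}" b l y] elem_sym_remove[of "I - {b}" a l y] assms
    by (simp add: pair_term_def algebra_simps)
qed

text \<open>For fixed \<open>a\<close> everything lives over \<open>I - {a}\<close>, where the two
  preceding sums apply. With \<open>a = n\<close> this handles the factor with the differences
  \<open>x i - x n\<close>.\<close>

lemma sum_pair_term_row:
  assumes "finite I" "a \<in> I"
  shows "(\<Sum>b\<in>I - {a}. pair_term l I y a b) =
    of_int (int (card I) - 1 - l) * elem_sym l (I - {a}) y
    - of_int (l + 1) * elem_sym (l + 1) (I - {a}) y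
    - of_int (int (card I) - 1) * (y a * elem_sym l (I - {a}) y)"
proof -
  let ?J = "I - {a}"
  have fin: "finite ?J" and card: "int (card ?J) = int (card I) - 1"
    using assms card_gt_0_iff[of I] by (auto simp: card_Diff_singleton)
  have "I - {a, b} = ?J - {b}" for b by auto
  then have "(\<Sum>b\<in>?J. pair_term l I y a b) =
      (1 - y a) * (\<Sum>b\<in>?J. elem_sym l (?J - {b}) y) - (\<Sum>b\<in>?J. y b * elem_sym l (?J - {b}) y)
      - y a * (\<Sum>b\<in>?J. y b * elem_sym (l - 1) (?J - {b}) y)"
    by (simp add: pair_term_def sum_distrib_left sum_subtractf sum.distrib algebra_simps)
  then show ?thesis
    by (simp add: sum_elem_sym_remove[OF fin] sum_mult_elem_sym_remove[OF fin] card algebra_simps)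
qed

lemma sum_pair_term:
  assumes "finite I"
  shows "(\<Sum>a\<in>I. \<Sum>b\<in>I - {a}. pair_term l I y a b) =
    of_int ((int (card I) - 1 - l) * (int (card I) - l)) * elem_sym l I y
    - of_int ((l + 1) * (2 * int (card I) - 2 - l)) * elem_sym (l + 1) I y"
proof -
  have "(\<Sum>a\<in>I. \<Sum>b\<in>I - {a}. pair_term l I y a b) =
      of_int (int (card I) - 1 - l) * (\<Sum>a\<in>I. elem_sym l (I - {a}) y)
      - of_int (l + 1) * (\<Sum>a\<in>I. elem_sym (l + 1) (I - {a}) y)
      - of_int (int (card I) - 1) * (\<Sum>a\<in>I. y a * elem_sym l (I - {a}) y)"
    using assms by (simp add: sum_pair_term_row sum_distrib_left sum_subtractf)
  then show ?thesis
    by (simp add: sum_elem_sym_remove[OF assms] sum_mult_elem_sym_remove[OF assms] algebra_simps)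
qed

text \<open>Each unordered pair is met twice on the right, once per order.\<close>

lemma sum_ordered_pairs:
  fixes q :: "nat \<Rightarrow> nat \<Rightarrow> 'a::comm_ring_1"
  assumes "\<And>a b. q a b = q b a"
  shows "2 * (\<Sum>(a, b) | 1 \<le> a \<and> a < b \<and> b \<le> n. q a b) = (\<Sum>a\<in>{1..n}. \<Sum>b\<in>{1..n} - {a}. q a b)"
proof -
  let ?P = "{(a, b). 1 \<le> a \<and> a < b \<and> b \<le> n}"
  let ?P' = "{(a, b). 1 \<le> b \<and> b < a \<and> a \<le> n}"
  have fin: "finite ?P" "finite ?P'"
    by (rule finite_subset[of _ "{1..n} \<times> {1..n}"]; auto)+
  have "(\<Sum>a\<in>{1..n}. \<Sum>b\<in>{1..n} - {a}. q a b) =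
      (\<Sum>(a, b)\<in>Sigma {1..n} (\<lambda>a. {1..n} - {a}). q a b)"
    by (rule sum.Sigma) auto
  also have "Sigma {1..n} (\<lambda>a. {1..n} - {a}) = ?P \<union> ?P'" by auto
  also have "(\<Sum>(a, b)\<in>?P \<union> ?P'. q a b) = (\<Sum>(a, b)\<in>?P. q a b) + (\<Sum>(a, b)\<in>?P'. q a b)"
    using fin by (intro sum.union_disjoint) auto
  also have "(\<Sum>(a, b)\<in>?P'. q a b) = (\<Sum>(a, b)\<in>?P. q a b)"
    by (rule sum.reindex_bij_witness[of _ prod.swap prod.swap]) (auto simp: assms)
  finally show ?thesis by simp
qed

section \<open>Euler operators on iterated Laurent series\<close>

lift_definition hahn_weight :: "('e::linorder \<Rightarrow> 'a::mult_zero) \<Rightarrow> ('e, 'a) hahn \<Rightarrow> ('e, 'a) hahn"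
  is "\<lambda>w f e. w e * f e"
  by (erule wfp_on_less_subset) auto

lemmas hahn_coeff_weight [simp] = hahn_weight.rep_eq[THEN fun_cong]

text \<open>In the convolution for exponent \<open>m\<close> every term satisfies
  \<open>w m = w a + w (m - a)\<close>, which is the Leibniz rule term by term.\<close>

lemma derivation_hahn_weight:
  fixes w :: "'e::linordered_ab_group_add \<Rightarrow> 'a::field"
  assumes w: "\<And>a b. w (a + b) = w a + w b"
  shows "derivation (hahn_weight w)"
proof
  fix f g :: "('e, 'a) hahn"
  show "hahn_weight w (f + g) = hahn_weight w f + hahn_weight w g"
    by (rule hahn_eqI) (simp add: algebra_simps)
  show "hahn_weight w (f * g) = hahn_weight w f * g + f * hahn_weight w g"
  proof (rule hahn_eqI)
    fix m
    \<comment> \<open>Weighting can only shrink a support, so this one index set serves all three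
      products.\<close>
    let ?T = "{a. hahn_coeff f a \<noteq> 0 \<and> hahn_coeff g (m - a) \<noteq> 0}"
    have *: "hahn_coeff (p * q) m = (\<Sum>a\<in>?T. hahn_coeff p a * hahn_coeff q (m - a))"
      if "p \<in> {f, hahn_weight w f}" "q \<in> {g, hahn_weight w g}" for p q
      by (rule hahn_coeff_mult_superset[OF finite_mult_support]) (use that in auto)
    have "w m = w a + w (m - a)" for a
      using w[of a "m - a"] by simp
    then have "w m * (hahn_coeff f a * hahn_coeff g (m - a)) =
        w a * hahn_coeff f a * hahn_coeff g (m - a) + hahn_coeff f a * (w (m - a) * hahn_coeff g (m - a))"
      for a by (metis distrib_right mult.assoc mult.left_commute)
    then show "hahn_coeff (hahn_weight w (f * g)) m =
        hahn_coeff (hahn_weight w f * g + f * hahn_weight w g) m"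
      by (simp only: hahn_coeff_weight hahn_coeff_add * insert_iff simp_thms sum_distrib_left sum.distrib)
  qed
qed

text \<open>A Laurent monomial is an eigenvector of x_i d/dx_i, with its exponent of x_i as
  eigenvalue.\<close>

definition euler :: "nat \<Rightarrow> laurent \<Rightarrow> laurent"
  where "euler i = hahn_weight (\<lambda>e. of_int (Poly_Mapping.lookup e (dual i)))"

interpretation euler: derivation "euler i" for i
  unfolding euler_def by (rule derivation_hahn_weight) (simp add: lookup_add)

lemma euler_X: "euler i (X j) = (if i = j then X j else 0)"
  by (rule hahn_eqI) (simp add: euler_def X_def var_exp_def lookup_single when_def)

lemma X_eq_iff [simp]: "X i = X j \<longleftrightarrow> i = j"
proof
  assume "X i = X j"
  then have "hahn_coeff (X i) (var_exp i 1) = hahn_coeff (X j) (var_exp i 1)" by simp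
  then have "Poly_Mapping.lookup (var_exp i 1) (dual i) = Poly_Mapping.lookup (var_exp j 1) (dual i)"
    by (simp add: X_def split: if_splits)
  then show "i = j" by (simp add: var_exp_def lookup_single when_def split: if_splits)
qed simp

lemma X_nonzero [simp]: "X i \<noteq> 0"
proof
  assume "X i = 0"
  then have "hahn_coeff (X i) (var_exp i 1) = 0" by simp
  then show False by (simp add: X_def)
qed

lemma X_neq_1 [simp]: "X i \<noteq> 1"
proof
  assume "X i = 1"
  then have "euler i (X i) = 0" by simp
  then show False by (simp add: euler_X)
qed

section \<open>Linearity of the residue and its vanishing on derivatives\<close>

lemma Res_add: "Res n (f + g) = Res n f + Res n g"
  by (simp add: Res_def)

lemma Res_sum: "Res n (\<Sum>i\<in>A. f i) = (\<Sum>i\<in>A. Res n (f i))"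
  by (induction A rule: infinite_finite_induct) (simp_all add: Res_add, simp_all add: Res_def)

lemma Res_of_int_mult: "Res n (of_int c * f) = of_int c * Res n f"
proof -
  have "Res n (of_nat m * f) = of_nat m * Res n f" for m
    by (induction m) (simp_all add: Res_def algebra_simps)
  then show ?thesis
    by (cases c rule: int_cases2) (simp_all add: Res_def)
qed

text \<open>The residue reads the coefficient whose exponent of x_i is -1, so \<open>euler i\<close>
  negates it. The argument is the derivative of x_i f in x_i.\<close>

lemma Res_divergence:
  assumes "i \<in> {1..n}"
  shows "Res n (f + euler i f) = 0"
proof -
  let ?e = "\<Sum>j=1..n. var_exp j (-1)"
  have "Poly_Mapping.lookup ?e (dual i) = (\<Sum>j=1..n. if j = i then -1 else 0)"
    unfolding lookup_sum
    by (rule sum.cong) (auto simp: var_exp_def lookup_single when_def)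
  also have "\<dots> = -1" using assms by simp
  finally show ?thesis by (simp add: Res_def euler_def)
qed

section \<open>The divergence\<close>

definition Psi :: "nat \<Rightarrow> int \<Rightarrow> nat \<Rightarrow> nat \<Rightarrow> nat \<Rightarrow> laurent"
  where "Psi n t k1 k2 k3 = (\<Prod>i=1..n. X i ^ k1) * (\<Prod>i=1..n-1. X i - X n) /
    (X n powi t * (\<Prod>i=1..n. (1 - X i) ^ k2) *
     (\<Prod>(i, j) | 1 \<le> i \<and> i < j \<and> j \<le> n. (X i - X j) ^ k3))"

lemma Phi_eq_Psi: "Phi n l t k1 k2 k3 = elem_sym l {1..n-1} (\<lambda>i. 1 - X i) * Psi n t k1 k2 k3"
  by (simp add: Phi_def Psi_def mult.assoc)

lemma Psi_pred: "Psi n (t - 1) k1 k2 k3 = X n * Psi n t k1 k2 k3"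
proof -
  have *: "X n powi t = X n * X n powi (t - 1)"
    using power_int_add_1'[of "X n" "t - 1"] by simp
  show ?thesis by (simp add: Psi_def *)
qed

lemma finite_ordered_pairs: "finite {(i::nat, j). 1 \<le> i \<and> i < j \<and> j \<le> n}"
  by (rule finite_subset[of _ "{1..n} \<times> {1..n}"]) auto

text \<open>Stated for an arbitrary derivation because \<open>V\<close> exists only inside the proof
  of \<open>divergence\<close>. The assumptions on \<open>x\<close> make all factors nonzero, so
  \<open>dlog\<close> turns the product into a sum.\<close>

lemma (in derivation) d_Psi:
  fixes x :: "nat \<Rightarrow> 'a"
    and n k1 k2 k3 :: nat and t :: int
  assumes "n \<ge> 1" "inj x" "\<And>i. x i \<noteq> 0" "\<And>i. x i \<noteq> 1"
  defines "psi \<equiv> (\<Prod>i=1..n. x i ^ k1) * (\<Prod>i=1..n-1. x i - x n) /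
    (x n powi t * (\<Prod>i=1..n. (1 - x i) ^ k2) *
     (\<Prod>(i, j) | 1 \<le> i \<and> i < j \<and> j \<le> n. (x i - x j) ^ k3))"
  shows "d psi = psi * (of_nat k1 * (\<Sum>i=1..n. dlog (x i)) + (\<Sum>i=1..n-1. dlog (x i - x n))
    - of_int t * dlog (x n) - of_nat k2 * (\<Sum>i=1..n. dlog (1 - x i))
    - of_nat k3 * (\<Sum>(i, j) | 1 \<le> i \<and> i < j \<and> j \<le> n. dlog (x i - x j)))"
proof -
  let ?P = "{(i, j). 1 \<le> i \<and> i < j \<and> j \<le> n}"
  have neq: "x i - x j \<noteq> 0" if "i \<noteq> j" for i j
    using that assms(2) by (auto simp: inj_eq)
  have neq1: "1 - x i \<noteq> 0" for i
    using assms(4)[of i] by auto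
  have p1: "(\<Prod>i=1..n. x i ^ k1) \<noteq> 0" "(\<Prod>i=1..n. (1 - x i) ^ k2) \<noteq> 0"
    using assms neq1 by auto
  have p2: "(\<Prod>i=1..n-1. x i - x n) \<noteq> 0"
    using assms(1) by (auto simp: inj_eq[OF assms(2)])
  have p3: "(\<Prod>(i, j)\<in>?P. (x i - x j) ^ k3) \<noteq> 0"
    using finite_ordered_pairs[of n] by (auto simp: inj_eq[OF assms(2)])
  have l2: "dlog (\<Prod>i=1..n-1. x i - x n) = (\<Sum>i=1..n-1. dlog (x i - x n))"
    using assms(1) by (intro dlog_prod neq) auto
  have l3: "dlog (\<Prod>(i, j)\<in>?P. (x i - x j) ^ k3) = (\<Sum>(i, j)\<in>?P. of_nat k3 * dlog (x i - x j))"
    by (subst dlog_prod) (auto intro!: sum.cong simp: dlog_power neq inj_eq[OF assms(2)])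
  have l1: "dlog (\<Prod>i=1..n. x i ^ k1) = of_nat k1 * (\<Sum>i=1..n. dlog (x i))"
    "dlog (\<Prod>i=1..n. (1 - x i) ^ k2) = of_nat k2 * (\<Sum>i=1..n. dlog (1 - x i))"
    using assms(3) neq1 by (simp_all add: dlog_prod dlog_power sum_distrib_left)
  have nz: "psi \<noteq> 0"
    using p1 p2 p3 assms(3) by (simp add: psi_def)
  have "dlog psi = of_nat k1 * (\<Sum>i=1..n. dlog (x i)) + (\<Sum>i=1..n-1. dlog (x i - x n))
    - of_int t * dlog (x n) - of_nat k2 * (\<Sum>i=1..n. dlog (1 - x i))
    - (\<Sum>(i, j)\<in>?P. of_nat k3 * dlog (x i - x j))"
  proof -
    have "dlog (a * b / (z * c * e)) = dlog a + dlog b - dlog z - dlog c - dlog e"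
      if "a \<noteq> 0" "b \<noteq> 0" "z \<noteq> 0" "c \<noteq> 0" "e \<noteq> 0" for a b z c e
      using that by (simp add: dlog_divide dlog_mult)
    from this[OF p1(1) p2 _ p1(2) p3, of "x n powi t"] show ?thesis
      using assms(3) by (simp only: psi_def l1 l2 l3 power_int_eq_0_iff) (simp add: dlog_power_int)
  qed
  moreover have "d psi = psi * dlog psi"
    using nz by (simp add: dlog_def)
  moreover have "(\<Sum>(i, j)\<in>?P. of_nat k3 * dlog (x i - x j)) =
      of_nat k3 * (\<Sum>(i, j)\<in>?P. dlog (x i - x j))"
    by (simp add: sum_distrib_left case_prod_unfold)
  ultimately show ?thesis by simp
qed

text \<open>Doubling avoids dividing by \<open>2\<close>: all coefficients are integers.\<close>

lemma divergence:
  fixes n k1 k2 k3 :: nat and l t :: int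
  defines "y \<equiv> \<lambda>i. 1 - X i"
  defines "v \<equiv> \<lambda>i. y i * elem_sym l ({1..n} - {i}) y"
  defines "e \<equiv> \<lambda>k. elem_sym k {1..n-1} y"
  defines "a \<equiv> 2 * (int k2 - int k1 - 2) + int k3 * (2 * int n - 2 - l)"
  defines "b \<equiv> 2 * (int k2 - 1) + int k3 * (int n - 1 - l)"
  assumes n: "n \<ge> 1"
  shows "2 * (\<Sum>i=1..n. v i * Psi n t k1 k2 k3 + euler i (v i * Psi n t k1 k2 k3)) =
    - Psi n t k1 k2 k3 *
      (of_int ((l + 1) * a) * (e (l + 1) + y n * e l) - of_int ((int n - l) * b) * (e l + y n * e (l - 1))
       - of_int (2 * (l + 1)) * e (l + 1) + of_int (2 * (int n - l - 1)) * e l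
       + of_int (2 * (t - int n + 1)) * (y n * e l))"
proof -
  let ?I = "{1..n}" and ?P = "{(i, j). 1 \<le> i \<and> i < j \<and> j \<le> n}" and ?Psi = "Psi n t k1 k2 k3"
  let ?q = "pair_term l {1..n} y"
  \<comment> \<open>\<open>E\<close> involves all \<open>n\<close> variables, whereas
    \<open>e\<close> omits the last one, as in \<open>Phi\<close>.\<close>
  define E where "E k = elem_sym k ?I y" for k
  define V where "V f = (\<Sum>i\<in>?I. v i * euler i f)" for f
  interpret V: derivation V
    by standard (simp_all add: V_def euler.add euler.mult algebra_simps sum.distrib sum_distrib_left sum_distrib_right)
  have V_X: "V (X i) = v i * X i" if "i \<in> ?I" for i
    using that by (simp add: V_def euler_X if_distrib cong: if_cong)
  have dlog_X: "V.dlog (X i) = v i" if "i \<in> ?I" for i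
    using V_X[OF that] by (simp add: V.dlog_def)
  have y_nz: "y i \<noteq> 0" for i
    using X_neq_1[of i] by (auto simp: y_def)
  \<comment> \<open>Here \<open>V (1 - X i) = - v i * X i\<close>; the factor \<open>y i\<close> of
    \<open>v i\<close> cancels, and \<open>X i = 1 - y i\<close>.\<close>
  have dlog_y: "V.dlog (1 - X i) = v i - elem_sym l (?I - {i}) y" if "i \<in> ?I" for i
  proof -
    have "V.dlog (1 - X i) = - (v i * X i) / y i"
      by (simp add: V.dlog_def V.diff V_X[OF that] y_def)
    also have "\<dots> = - (elem_sym l (?I - {i}) y * X i)"
      using y_nz[of i] by (simp add: v_def)
    also have "\<dots> = v i - elem_sym l (?I - {i}) y"
      by (simp add: v_def y_def algebra_simps)
    finally show ?thesis .
  qed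
  \<comment> \<open>The sign comes from \<open>X i - X j = - (y i - y j)\<close>, and
    \<open>v i * X i\<close> is the expression whose divided difference \<open>pair_term\<close>
    is.\<close>
  have dlog_diff: "V.dlog (X i - X j) = - ?q i j" if "i \<in> ?I" "j \<in> ?I" "i \<noteq> j" for i j
  proof -
    have nz: "X i - X j \<noteq> 0" using that by simp
    have "(X i - X j) * ?q i j = - (v i * X i - v j * X j)"
      using pair_term_divided_difference[of ?I i j y l] that
      by (simp add: v_def y_def algebra_simps)
    then show ?thesis
      using nz by (simp add: V.dlog_def V.diff V_X[OF that(1)] V_X[OF that(2)] field_simps)
  qed
  have I_eq: "?I = insert n {1..n-1}" "n \<notin> {1..n-1}" and J: "?I - {n} = {1..n-1}"
    using n by auto
  have E: "E k = e k + y n * e (k - 1)" for k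
    unfolding E_def e_def I_eq(1) by (rule elem_sym_insert) (use I_eq(2) in auto)
  \<comment> \<open>The polynomial omits index \<open>i\<close>, hence is constant for
    \<open>euler i\<close>; the rest is \<open>euler i (y i) = - X i = y i - 1\<close>.\<close>
  have euler_v: "euler i (v i) = v i - elem_sym l (?I - {i}) y" for i
  proof -
    have "euler i (elem_sym l (?I - {i}) y) = 0"
      by (rule euler.elem_sym_eq_0) (auto simp: y_def euler.diff euler_X)
    moreover have "euler i (y i) = y i - 1"
      by (simp add: y_def euler.diff euler_X)
    ultimately show ?thesis by (simp add: v_def euler.mult left_diff_distrib)
  qed
  have sum_v: "(\<Sum>i\<in>?I. v i) = of_int (l + 1) * E (l + 1)"
    unfolding v_def E_def by (rule sum_mult_elem_sym_remove) simp
  have sum_e: "(\<Sum>i\<in>?I. elem_sym l (?I - {i}) y) = of_int (int n - l) * E l"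
    unfolding E_def by (subst sum_elem_sym_remove) simp_all
  have W: "(\<Sum>i=1..n-1. V.dlog (X i - X n)) = - (of_int (int n - 1 - l) * e l
      - of_int (l + 1) * e (l + 1) - of_int (int n - 1) * (y n * e l))"
  proof -
    have "(\<Sum>i=1..n-1. V.dlog (X i - X n)) = - (\<Sum>i\<in>?I - {n}. ?q n i)"
      unfolding J sum_negf[symmetric]
      by (intro sum.cong refl) (use n in \<open>auto simp: dlog_diff pair_term_commute[of _ _ _ n]\<close>)
    also have "(\<Sum>i\<in>?I - {n}. ?q n i) = of_int (int n - 1 - l) * e l
      - of_int (l + 1) * e (l + 1) - of_int (int n - 1) * (y n * e l)"
      unfolding e_def J[symmetric] by (subst sum_pair_term_row) (use n in auto)
    finally show ?thesis .
  qed
  have Q: "2 * (\<Sum>(i, j)\<in>?P. V.dlog (X i - X j)) = - (of_int ((int n - 1 - l) * (int n - l)) * E l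
      - of_int ((l + 1) * (2 * int n - 2 - l)) * E (l + 1))"
  proof -
    have "(\<Sum>(i, j)\<in>?P. V.dlog (X i - X j)) = - (\<Sum>(i, j)\<in>?P. ?q i j)"
      unfolding sum_negf[symmetric] by (intro sum.cong refl) (auto simp: dlog_diff)
    then have "2 * (\<Sum>(i, j)\<in>?P. V.dlog (X i - X j)) = - (\<Sum>a\<in>?I. \<Sum>b\<in>?I - {a}. ?q a b)"
      using sum_ordered_pairs[of ?q n, OF pair_term_commute] by simp
    then show ?thesis
      unfolding E_def by (subst (asm) sum_pair_term) simp_all
  qed
  have dlog_n: "V.dlog (X n) = y n * e l"
    using n dlog_X[of n] unfolding v_def e_def J by simp
  have sum_X: "(\<Sum>i\<in>?I. V.dlog (X i)) = of_int (l + 1) * E (l + 1)"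
    unfolding sum_v[symmetric] by (intro sum.cong refl dlog_X)
  have sum_y: "(\<Sum>i\<in>?I. V.dlog (1 - X i)) = of_int (l + 1) * E (l + 1) - of_int (int n - l) * E l"
    by (simp only: sum_v[symmetric] sum_e[symmetric] sum_subtractf[symmetric])
      (intro sum.cong refl dlog_y)
  have V_Psi: "V ?Psi = ?Psi * (of_nat k1 * (of_int (l + 1) * E (l + 1))
    - (of_int (int n - 1 - l) * e l - of_int (l + 1) * e (l + 1) - of_int (int n - 1) * (y n * e l))
    - of_int t * (y n * e l) - of_nat k2 * (of_int (l + 1) * E (l + 1) - of_int (int n - l) * E l)
    - of_nat k3 * (\<Sum>(i, j)\<in>?P. V.dlog (X i - X j)))"
  proof -
    have "inj X" by (simp add: inj_def)
    from V.d_Psi[OF n this X_nonzero X_neq_1, folded Psi_def,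
        where t = t and ?k1.0 = k1 and ?k2.0 = k2 and ?k3.0 = k3]
    show ?thesis
      unfolding sum_X sum_y W dlog_n by (simp only: add_uminus_conv_diff)
  qed
  have "(\<Sum>i\<in>?I. v i * ?Psi + euler i (v i * ?Psi)) =
      (\<Sum>i\<in>?I. v i + euler i (v i)) * ?Psi + V ?Psi"
    by (simp add: V_def euler.mult distrib_right sum.distrib mult.assoc flip: sum_distrib_right)
  also have "(\<Sum>i\<in>?I. v i + euler i (v i)) =
      2 * (of_int (l + 1) * E (l + 1)) - of_int (int n - l) * E l"
    unfolding euler_v sum_v[symmetric] sum_e[symmetric]
    by (simp add: sum.distrib sum_subtractf flip: sum_distrib_left)
  finally have div: "(\<Sum>i\<in>?I. v i * ?Psi + euler i (v i * ?Psi)) =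
      (2 * (of_int (l + 1) * E (l + 1)) - of_int (int n - l) * E l) * ?Psi + V ?Psi" .
  \<comment> \<open>Proved with opaque variables; it groups the pair sum as \<open>2 * S\<close>,
    the form in which \<open>Q\<close> evaluates it.\<close>
  have double: "2 * ((2 * A - B) * P + P * (K1 * A - R - T * Y - K2 * (A - B) - K3 * S)) =
      P * (2 * (2 * A - B) + 2 * K1 * A - 2 * R - 2 * T * Y - 2 * K2 * (A - B) - K3 * (2 * S))"
    for A B P K1 R T Y K2 K3 S :: laurent
    by (simp add: algebra_simps)
  \<comment> \<open>The multiples of \<open>E (l + 1)\<close> combine to
    \<open>- (l + 1) * a\<close> and those of \<open>E l\<close> to \<open>(n - l) * b\<close>; then
    \<open>E\<close> is expressed by \<open>e\<close>.\<close>
  have collect: "2 * (2 * (of_int (l + 1) * E (l + 1)) - of_int (int n - l) * E l)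
       + 2 * of_nat k1 * (of_int (l + 1) * E (l + 1))
       - 2 * (of_int (int n - 1 - l) * e l - of_int (l + 1) * e (l + 1) - of_int (int n - 1) * (y n * e l))
       - 2 * of_int t * (y n * e l)
       - 2 * of_nat k2 * (of_int (l + 1) * E (l + 1) - of_int (int n - l) * E l)
       - of_nat k3 * (- (of_int ((int n - 1 - l) * (int n - l)) * E l
          - of_int ((l + 1) * (2 * int n - 2 - l)) * E (l + 1))) =
    - (of_int ((l + 1) * a) * (e (l + 1) + y n * e l) - of_int ((int n - l) * b) * (e l + y n * e (l - 1))
       - of_int (2 * (l + 1)) * e (l + 1) + of_int (2 * (int n - l - 1)) * e l
       + of_int (2 * (t - int n + 1)) * (y n * e l))"
    unfolding E a_def b_def by (simp add: algebra_simps)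
  show ?thesis
    unfolding div V_Psi double Q collect by (simp only: mult_minus_left mult_minus_right)
qed

section \<open>The recurrence as the vanishing residue of the divergence\<close>

theorem proposition4p4:
  fixes n k1 k2 k3 :: nat and l t :: int
    and A_succ A A_bar A_pred A_bar_pred :: rat
  assumes "n \<ge> 3"
    and "A_succ = (of_int l + 1) *
      (of_nat k2 - of_nat k1 - 3 + of_nat k3 / 2 * (2 * of_nat n - 2 - of_int l))"
    and "A = of_int t - of_nat n
      + (of_int l + 1) *
        (of_nat k2 - of_nat k1 - 2 + of_nat k3 / 2 * (2 * of_nat n - 2 - of_int l))
      - (of_nat n - of_int l) * (of_nat k2 - 2 + of_nat k3 / 2 * (of_nat n - 1 - of_int l))"
    and "A_bar = - (of_int t - of_nat n + 1
      + (of_int l + 1) *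
        (of_nat k2 - of_nat k1 - 2 + of_nat k3 / 2 * (2 * of_nat n - 2 - of_int l)))"
    and "A_pred = - ((of_nat n - of_int l) *
        (of_nat k2 - 1 + of_nat k3 / 2 * (of_nat n - 1 - of_int l)))"
    and "A_bar_pred = - A_pred"
  shows "A_succ * D n (l + 1) t k1 k2 k3 + A * D n l t k1 k2 k3
    + A_bar * D n l (t - 1) k1 k2 k3 + A_pred * D n (l - 1) t k1 k2 k3
    + A_bar_pred * D n (l - 1) (t - 1) k1 k2 k3 = 0"
proof -
  let ?y = "\<lambda>i. 1 - X i" and ?Psi = "Psi n t k1 k2 k3"
  let ?e = "\<lambda>k. elem_sym k {1..n-1} ?y"
  let ?v = "\<lambda>i. ?y i * elem_sym l ({1..n} - {i}) ?y"
  let ?D = "\<lambda>l t. D n l t k1 k2 k3"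
  \<comment> \<open>\<open>a\<close> is twice the bracket in \<open>A_bar\<close>, \<open>b\<close>
    twice the bracket in \<open>A_pred\<close>, and \<open>c\<close> is \<open>- 2 * A_bar\<close>.
    The brackets with -3 in \<open>A_succ\<close> and with \<open>k2 - 2\<close> in \<open>A\<close>
    are the halves of \<open>a - 2\<close> and \<open>b - 2\<close>.\<close>
  define a where "a = 2 * (int k2 - int k1 - 2) + int k3 * (2 * int n - 2 - l)"
  define b where "b = 2 * (int k2 - 1) + int k3 * (int n - 1 - l)"
  define c where "c = (l + 1) * a + 2 * (t - int n + 1)"
  let ?F = "\<Sum>i=1..n. ?v i * ?Psi + euler i (?v i * ?Psi)"
  have D: "?D l t = Res n (?e l * ?Psi)" "?D l (t - 1) = Res n (X n * (?e l * ?Psi))" for l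
    by (simp_all add: D_def Phi_eq_Psi Psi_pred algebra_simps)
  \<comment> \<open>Replacing \<open>y n\<close> by \<open>1 - X n\<close> splits each product
    \<open>y n * e k\<close> into a term at \<open>t\<close> and one with the factor
    \<open>X n\<close>, which is the term at \<open>t - 1\<close>.\<close>
  have "of_int (- 2) * ?F = of_int ((l + 1) * (a - 2)) * (?e (l + 1) * ?Psi)
      + of_int (c - (int n - l) * b + 2 * (int n - l - 1)) * (?e l * ?Psi)
      + of_int (- c) * (X n * (?e l * ?Psi))
      + of_int (- ((int n - l) * b)) * (?e (l - 1) * ?Psi)
      + of_int ((int n - l) * b) * (X n * (?e (l - 1) * ?Psi))"
    using divergence[of n l t k1 k2 k3] assms(1)
    unfolding a_def[symmetric] b_def[symmetric] c_def
    by (simp add: algebra_simps)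
  from arg_cong[OF this, of "Res n"]
  have "of_int (- 2) * Res n ?F = of_int ((l + 1) * (a - 2)) * ?D (l + 1) t
      + of_int (c - (int n - l) * b + 2 * (int n - l - 1)) * ?D l t
      + of_int (- c) * ?D l (t - 1)
      + of_int (- ((int n - l) * b)) * ?D (l - 1) t
      + of_int ((int n - l) * b) * ?D (l - 1) (t - 1)"
    by (simp only: Res_add Res_of_int_mult D)
  moreover have "Res n ?F = 0"
    unfolding Res_sum by (intro sum.neutral ballI Res_divergence)
  moreover have "of_int ((l + 1) * (a - 2)) = 2 * A_succ"
    "of_int (c - (int n - l) * b + 2 * (int n - l - 1)) = 2 * A"
    "of_int (- c) = 2 * A_bar"
    "of_int (- ((int n - l) * b)) = 2 * A_pred"
    "of_int ((int n - l) * b) = 2 * A_bar_pred"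
    unfolding assms a_def b_def c_def by (simp_all add: field_simps)
  ultimately show ?thesis by (simp only:)
qed

end
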